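(* Let $K$ be the infinite king's grid. Then $\mathrm{RED{:}IC}\%(K) \ge \frac{3}{11}$, where $\mathrm{RED{:}IC}\%(K)$ denotes the lowest density of a redundant identifying code (RED:IC) on $K$.
   Context: The infinite king's grid $K$ is the infinite graph with vertex set $\mathbb{Z}^2$ in which two distinct vertices $(a,b)$ and $(c,d)$ are adjacent if and only if $\max(|a-c|,|b-d|)=1$ (so $K$ is 8-regular). $N[v]$ denotes the closed neighborhood of $v$ (the set consisting of $v$ and all vertices adjacent to $v$). A set $S \subseteq V(G)$ of vertices of a graph $G$ is an identifying code (IC) if, for every vertex $v$, $N[v]\cap S \neq \varnothing$, and for all distinct vertices $u,v$, $N[u]\cap S \ne N[v]\cap S$. A set $S$ is a redundant identifying code (RED:IC) if for every $D \subseteq S$ with $|D|\le 1$, the set $S - D$ is an IC (in particular $S$ itself is an IC). The density of $S\subseteq V(K)$ is the ratio of the size of $S$ to that of $V(K)$, understood as $\limsup_{n\to\infty} \frac{|S\cap Q_n|}{|Q_n|}$ with $Q_n=\{-n,\dots,n\}^2$. $\mathrm{RED{:}IC}\%(K)$ is the infimum of the densities of all RED:ICs on $K$. *)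

theory Defs
  imports Complex_Main "HOL-Library.Extended_Real"
begin

text \<open>A graph is given by its vertex set \<open>V\<close> and its (symmetric, irreflexive) adjacency
  relation \<open>adj\<close>.\<close>

definition closed_nbhd :: "'a set \<Rightarrow> ('a \<Rightarrow> 'a \<Rightarrow> bool) \<Rightarrow> 'a \<Rightarrow> 'a set" where
  "closed_nbhd V adj v = insert v {u \<in> V. adj v u}"

definition identifying_code :: "'a set \<Rightarrow> ('a \<Rightarrow> 'a \<Rightarrow> bool) \<Rightarrow> 'a set \<Rightarrow> bool" where
  "identifying_code V adj S \<longleftrightarrow>
     S \<subseteq> V \<and>
     (\<forall>v\<in>V. closed_nbhd V adj v \<inter> S \<noteq> {}) \<and>
     (\<forall>u\<in>V. \<forall>v\<in>V. u \<noteq> v \<longrightarrow> closed_nbhd V adj u \<inter> S \<noteq> closed_nbhd V adj v \<inter> S)"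

text \<open>Finiteness of \<open>D\<close> must be demanded explicitly, since \<open>card\<close> is \<open>0\<close> on infinite sets.\<close>

definition redundant_identifying_code :: "'a set \<Rightarrow> ('a \<Rightarrow> 'a \<Rightarrow> bool) \<Rightarrow> 'a set \<Rightarrow> bool" where
  "redundant_identifying_code V adj S \<longleftrightarrow>
     S \<subseteq> V \<and> (\<forall>D. D \<subseteq> S \<and> finite D \<and> card D \<le> 1 \<longrightarrow> identifying_code V adj (S - D))"

definition king_vertices :: "(int \<times> int) set" where
  "king_vertices = UNIV"

definition king_adj :: "int \<times> int \<Rightarrow> int \<times> int \<Rightarrow> bool" where
  "king_adj u v \<longleftrightarrow> u \<noteq> v \<and> max \<bar>fst u - fst v\<bar> \<bar>snd u - snd v\<bar> = 1"

definition king_box :: "nat \<Rightarrow> (int \<times> int) set" where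
  "king_box n = {- int n..int n} \<times> {- int n..int n}"

definition king_density :: "(int \<times> int) set \<Rightarrow> ereal" where
  "king_density S =
     limsup (\<lambda>n. ereal (real (card (S \<inter> king_box n)) / real (card (king_box n))))"

definition king_REDIC_density :: ereal where
  "king_REDIC_density =
     (INF S \<in> {S. redundant_identifying_code king_vertices king_adj S}. king_density S)"

text \<open>The infimum above is not over the empty set: all of \<open>\<int>\<^sup>2\<close> is a redundant identifying code.\<close>

lemma closed_nbhd_king_iff:
  "w \<in> closed_nbhd king_vertices king_adj v \<longleftrightarrow>
     \<bar>fst v - fst w\<bar> \<le> 1 \<and> \<bar>snd v - snd w\<bar> \<le> 1"
  by (auto simp: closed_nbhd_def king_vertices_def king_adj_def prod_eq_iff max_def)

lemma redundant_identifying_code_king_vertices: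
  "redundant_identifying_code king_vertices king_adj king_vertices"
proof -
  let ?N = "closed_nbhd king_vertices king_adj"
  have sep: "\<exists>x y. x \<noteq> y \<and> x \<in> ?N u - ?N v \<union> (?N v - ?N u) \<and> y \<in> ?N u - ?N v \<union> (?N v - ?N u)"
    if "u \<noteq> v" for u v
  proof -
    consider "fst u < fst v" | "fst v < fst u" | "snd u < snd v" | "snd v < snd u"
      using \<open>u \<noteq> v\<close> by (metis linorder_neqE prod_eq_iff)
    then show ?thesis
    proof cases
      case 1
      then show ?thesis
        by (intro exI[of _ "(fst u - 1, snd u)"] exI[of _ "(fst u - 1, snd u + 1)"])
           (simp add: closed_nbhd_king_iff)
    next
      case 2
      then show ?thesis
        by (intro exI[of _ "(fst v - 1, snd v)"] exI[of _ "(fst v - 1, snd v + 1)"])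
           (simp add: closed_nbhd_king_iff)
    next
      case 3
      then show ?thesis
        by (intro exI[of _ "(fst u, snd u - 1)"] exI[of _ "(fst u + 1, snd u - 1)"])
           (simp add: closed_nbhd_king_iff)
    next
      case 4
      then show ?thesis
        by (intro exI[of _ "(fst v, snd v - 1)"] exI[of _ "(fst v + 1, snd v - 1)"])
           (simp add: closed_nbhd_king_iff)
    qed
  qed
  have "identifying_code king_vertices king_adj (king_vertices - D)"
    if D: "finite D" "card D \<le> 1" for D
  proof -
    have D1: "x = y" if "x \<in> D" "y \<in> D" for x y
      using D that by (metis One_nat_def card_le_Suc0_iff_eq)
    have "?N v \<inter> (king_vertices - D) \<noteq> {}" for v
    proof -
      have "v \<in> ?N v" "(fst v + 1, snd v) \<in> ?N v" "v \<noteq> (fst v + 1, snd v)"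
        by (simp_all add: closed_nbhd_king_iff prod_eq_iff)
      then show ?thesis
        using D1 unfolding king_vertices_def by blast
    qed
    moreover have "?N u \<inter> (king_vertices - D) \<noteq> ?N v \<inter> (king_vertices - D)" if "u \<noteq> v" for u v
      using sep[OF that] D1 unfolding king_vertices_def by blast
    ultimately show ?thesis
      by (simp add: identifying_code_def)
  qed
  then show ?thesis
    by (simp add: redundant_identifying_code_def)
qed

end

(* In a redundant identifying code S every vertex has at least two code vertices in its closed
   neighbourhood, and the neighbourhoods of two distinct vertices differ in at least two code
   vertices. For horizontal neighbours the difference consists of two columns of three cells at
   distance 3. Let d(y) be the number of code vertices in N[y]. If the middle column of N[y]
   contains a code vertex, then adding the column conditions for (y - e, y) and (y, y + e) gives
   d(y - e) + d(y + e) >= 6, where e = (1, 0); hence 1 / d(y - e) + 1 / d(y + e) <= 3 / 4.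
   Now let x be a code vertex. The eight neighbours of x are paired off by the top and bottom
   rows of N[x] and by its middle row and middle column, so the share of x, the sum of 1 / d(y)
   over y in N[x], is at most 4 * 3 / 4 + 1 / 2 = 7 / 2. Double counting the shares yields
   density at least 2 / 7, which exceeds 3 / 11. *)

theory Submission
  imports Defs "HOL-Real_Asymp.Real_Asymp"
begin

abbreviation king_nbhd :: "int \<times> int \<Rightarrow> (int \<times> int) set" where
  "king_nbhd \<equiv> closed_nbhd king_vertices king_adj"

abbreviation king_redic :: "(int \<times> int) set \<Rightarrow> bool" where
  "king_redic \<equiv> redundant_identifying_code king_vertices king_adj"

text \<open>With at most one code vertex in the neighbourhood, deleting it would leave
  \<open>v\<close> undominated.\<close>

lemma card_closed_nbhd_ge_2:
  assumes S: "redundant_identifying_code V adj S" and v: "v \<in> V"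
    and fin: "finite (closed_nbhd V adj v)"
  shows "card (closed_nbhd V adj v \<inter> S) \<ge> 2"
proof (rule ccontr)
  let ?D = "closed_nbhd V adj v \<inter> S"
  assume "\<not> card ?D \<ge> 2"
  then have "identifying_code V adj (S - ?D)"
    using S fin by (simp add: redundant_identifying_code_def)
  then show False
    using v unfolding identifying_code_def by blast
qed

text \<open>Were there at most one separating code vertex, deleting it would give \<open>u\<close>
  and \<open>v\<close> the same trace on the code.\<close>

lemma card_closed_nbhd_sym_diff_ge_2:
  assumes S: "redundant_identifying_code V adj S" and uv: "u \<in> V" "v \<in> V" "u \<noteq> v"
    and fin: "finite (closed_nbhd V adj u)" "finite (closed_nbhd V adj v)"
  shows "card (sym_diff (closed_nbhd V adj u) (closed_nbhd V adj v) \<inter> S) \<ge> 2"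
proof (rule ccontr)
  let ?D = "sym_diff (closed_nbhd V adj u) (closed_nbhd V adj v) \<inter> S"
  assume "\<not> card ?D \<ge> 2"
  then have "identifying_code V adj (S - ?D)"
    using S fin by (simp add: redundant_identifying_code_def)
  moreover have "closed_nbhd V adj u \<inter> (S - ?D) = closed_nbhd V adj v \<inter> (S - ?D)"
    by blast
  ultimately show False
    using uv unfolding identifying_code_def by blast
qed

lemma mem_king_vertices [simp]: "v \<in> king_vertices"
  by (simp add: king_vertices_def)

lemma king_nbhd_eq: "king_nbhd (i, j) = {i-1, i, i+1} \<times> {j-1, j, j+1}"
proof -
  have "\<bar>a - b\<bar> \<le> 1 \<longleftrightarrow> b \<in> {a-1, a, a+1}" for a b :: int
    by auto
  then show ?thesis
    by (intro set_eqI) (simp only: closed_nbhd_king_iff mem_Times_iff fst_conv snd_conv)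
qed

lemma finite_king_nbhd [simp]: "finite (king_nbhd v)"
  by (cases v) (simp add: king_nbhd_eq)

lemma king_nbhd_commute: "u \<in> king_nbhd v \<longleftrightarrow> v \<in> king_nbhd u"
  by (auto simp: closed_nbhd_king_iff)

text \<open>Turns counts over rectangles into iterated sums, so that column and row counts can be
  compared by linear arithmetic.\<close>

lemma card_Times_Int:
  assumes "finite A" "finite B"
  shows "card ((A \<times> B) \<inter> S) = (\<Sum>a\<in>A. \<Sum>b\<in>B. of_bool ((a, b) \<in> S))"
proof -
  have "card ((A \<times> B) \<inter> S) = (\<Sum>v\<in>A \<times> B. of_bool (v \<in> S))"
    using assms by (simp add: of_bool_def sum.If_cases)
  then show ?thesis
    by (simp add: sum.cartesian_product split_def)
qed

lemma sym_diff_Times_left: "sym_diff (A \<times> C) (B \<times> C) = sym_diff A B \<times> C"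
  by blast

lemma sym_diff_Times_right: "sym_diff (C \<times> A) (C \<times> B) = C \<times> sym_diff A B"
  by blast

lemma card_columns_ge_2:
  assumes "king_redic S"
  shows "card (({a, a+3} \<times> {j-1, j, j+1}) \<inter> S) \<ge> 2"
proof -
  \<comment> \<open>The two columns are what separates the neighbours with first coordinates
    \<open>a+1\<close> and \<open>a+2\<close>; \<open>a+1+1\<close> matches the form that
    \<open>king_nbhd_eq\<close> produces.\<close>
  have "sym_diff {a, a+1, a+1+1} {a+1, a+1+1, a+1+1+1} = {a, a+3}"
    by auto
  then have "sym_diff (king_nbhd (a+1, j)) (king_nbhd (a+1+1, j)) = {a, a+3} \<times> {j-1, j, j+1}"
    by (simp only: king_nbhd_eq sym_diff_Times_left add_diff_cancel_right')
  then show ?thesis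
    using card_closed_nbhd_sym_diff_ge_2[OF assms, of "(a+1, j)" "(a+1+1, j)"] by simp
qed

lemma card_rows_ge_2:
  assumes "king_redic S"
  shows "card (({i-1, i, i+1} \<times> {b, b+3}) \<inter> S) \<ge> 2"
proof -
  have "sym_diff {b, b+1, b+1+1} {b+1, b+1+1, b+1+1+1} = {b, b+3}"
    by auto
  then have "sym_diff (king_nbhd (i, b+1)) (king_nbhd (i, b+1+1)) = {i-1, i, i+1} \<times> {b, b+3}"
    by (simp only: king_nbhd_eq sym_diff_Times_right add_diff_cancel_right')
  then show ?thesis
    using card_closed_nbhd_sym_diff_ge_2[OF assms, of "(i, b+1)" "(i, b+1+1)"] by simp
qed

lemma card_nbhd_horizontal_ge_6:
  assumes S: "king_redic S" and x: "(i, k) \<in> S" "k \<in> {j-1, j, j+1}"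
  shows "card (king_nbhd (i-1, j) \<inter> S) + card (king_nbhd (i+1, j) \<inter> S) \<ge> 6"
proof -
  define e :: "int \<Rightarrow> nat" where "e a = (\<Sum>b\<in>{j-1, j, j+1}. of_bool ((a, b) \<in> S))" for a
  have card_eq: "card ((A \<times> {j-1, j, j+1}) \<inter> S) = (\<Sum>a\<in>A. e a)" if "finite A" for A
    using that unfolding e_def by (simp only: card_Times_Int finite.intros)
  have columns: "e a + e (a+3) \<ge> 2" for a
    using card_columns_ge_2[OF S, of a j] by (simp only: card_eq finite.intros) simp
  have nbhd: "card (king_nbhd (a, j) \<inter> S) = e (a-1) + e a + e (a+1)" for a
    by (simp only: king_nbhd_eq card_eq finite.intros) simp
  have "e i \<ge> 1"
    using x member_le_sum[of k "{j-1, j, j+1}" "\<lambda>b. of_bool ((i, b) \<in> S) :: nat"]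
    by (simp add: e_def del: insert_iff)
  \<comment> \<open>The two neighbourhoods cover columns \<open>i-2\<close> to \<open>i\<close> and
    \<open>i\<close> to \<open>i+2\<close>. Column \<open>i\<close> counts twice, and the other four
    pair up at distance 3, so the total is at least 2 + 2 + 2.\<close>
  then show ?thesis
    using columns[of "i-2"] columns[of "i-1"] by (simp add: nbhd algebra_simps)
qed

lemma card_nbhd_vertical_ge_6:
  assumes S: "king_redic S" and x: "(k, j) \<in> S" "k \<in> {i-1, i, i+1}"
  shows "card (king_nbhd (i, j-1) \<inter> S) + card (king_nbhd (i, j+1) \<inter> S) \<ge> 6"
proof -
  define e :: "int \<Rightarrow> nat" where "e b = (\<Sum>a\<in>{i-1, i, i+1}. of_bool ((a, b) \<in> S))" for b
  have card_eq: "card (({i-1, i, i+1} \<times> B) \<inter> S) = (\<Sum>b\<in>B. e b)" if "finite B" for B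
    \<comment> \<open>\<open>card_Times_Int\<close> sums over the first coordinate outermost,
      whereas counting by rows needs the second outermost.\<close>
    using that unfolding e_def by (subst sum.swap) (simp only: card_Times_Int finite.intros)
  have rows: "e b + e (b+3) \<ge> 2" for b
    using card_rows_ge_2[OF S, of i b] by (simp only: card_eq finite.intros) simp
  have nbhd: "card (king_nbhd (i, b) \<inter> S) = e (b-1) + e b + e (b+1)" for b
    by (simp only: king_nbhd_eq card_eq finite.intros) simp
  have "e j \<ge> 1"
    using x member_le_sum[of k "{i-1, i, i+1}" "\<lambda>a. of_bool ((a, j) \<in> S) :: nat"]
    by (simp add: e_def del: insert_iff)
  then show ?thesis
    using rows[of "j-2"] rows[of "j-1"] by (simp add: nbhd algebra_simps)
qed

text \<open>The extreme case is {a, b} = {2, 4}, where equality holds.\<close>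

lemma inverse_sum_le_three_quarters:
  fixes a b :: real
  assumes "a \<ge> 2" "b \<ge> 2" "a + b \<ge> 6"
  shows "1 / a + 1 / b \<le> 3 / 4"
proof -
  have "0 \<le> (a - 2) * (b - 2)"
    using assms by simp
  then have "4 * (a + b) \<le> 3 * (a * b)"
    using assms(3) by (simp add: algebra_simps)
  then show ?thesis
    using assms by (simp add: field_simps)
qed

lemma share_le:
  assumes S: "king_redic S" and x: "x \<in> S"
  shows "(\<Sum>y\<in>king_nbhd x. 1 / real (card (king_nbhd y \<inter> S))) \<le> 7 / 2"
proof -
  define f where "f y = 1 / real (card (king_nbhd y \<inter> S))" for y
  obtain i j where ij: "x = (i, j)"
    by fastforce
  have ge2: "card (king_nbhd y \<inter> S) \<ge> 2" for y
    using card_closed_nbhd_ge_2[OF S] by simp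
  have pair: "f y + f z \<le> 3 / 4"
    if "card (king_nbhd y \<inter> S) + card (king_nbhd z \<inter> S) \<ge> 6" for y z
    unfolding f_def using ge2[of y] ge2[of z] that
    by (intro inverse_sum_le_three_quarters) linarith+
  \<comment> \<open>\<open>x\<close> lies in the middle column of the neighbourhood of (i, l), since
    j and l differ by at most 1.\<close>
  have horizontal: "f (i-1, l) + f (i+1, l) \<le> 3 / 4" if "l \<in> {j-1, j, j+1}" for l
  proof (intro pair card_nbhd_horizontal_ge_6[OF S])
    show "(i, j) \<in> S"
      using x ij by simp
    show "j \<in> {l-1, l, l+1}"
      using that by auto
  qed
  have vertical: "f (i, j-1) + f (i, j+1) \<le> 3 / 4"
    using x unfolding ij by (intro pair card_nbhd_vertical_ge_6[OF S]) auto
  have "f x \<le> 1 / 2"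
    using ge2[of x] by (simp add: f_def field_simps)
  moreover have "(\<Sum>y\<in>king_nbhd x. f y) =
      (\<Sum>l\<in>{j-1, j, j+1}. f (i-1, l) + f (i+1, l)) + (f (i, j-1) + f (i, j+1)) + f x"
    unfolding ij king_nbhd_eq sum.cartesian_product' by simp
  moreover have "(\<Sum>l\<in>{j-1, j, j+1}. f (i-1, l) + f (i+1, l)) \<le> (\<Sum>l\<in>{j-1, j, j+1}. 3 / 4)"
    using horizontal by (rule sum_mono)
  ultimately show ?thesis
    using vertical by (simp add: f_def)
qed

lemma finite_king_box [simp]: "finite (king_box n)"
  by (simp add: king_box_def)

lemma card_king_box: "card (king_box n) = (2 * n + 1)\<^sup>2"
proof -
  have "nat (2 * int n + 1) = 2 * n + 1"
    by simp
  then show ?thesis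
    by (simp only: king_box_def card_cartesian_product card_atLeastAtMost_int power2_eq_square)
       simp
qed

lemma king_nbhd_subset_king_box:
  assumes "y \<in> king_box n"
  shows "king_nbhd y \<subseteq> king_box (Suc n)"
  using assms by (cases y) (auto simp: king_box_def king_nbhd_eq)

text \<open>Each vertex of the box splits a unit charge equally among the code vertices of its
  neighbourhood, and a code vertex receives at most its share. The larger box catches the code
  vertices just outside the boundary.\<close>

lemma card_king_box_le:
  assumes S: "king_redic S"
  shows "real (card (king_box n)) \<le> 7 / 2 * real (card (S \<inter> king_box (Suc n)))"
proof -
  let ?d = "\<lambda>y. card (king_nbhd y \<inter> S)"
  let ?T = "S \<inter> king_box (Suc n)"
  have "?d y \<ge> 2" for y
    using card_closed_nbhd_ge_2[OF S] by simp
  then have pos: "?d y \<noteq> 0" for y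
    by (metis not_numeral_le_zero)
  have "real (card (king_box n)) = (\<Sum>y\<in>king_box n. \<Sum>x\<in>king_nbhd y \<inter> S. 1 / ?d y)"
    using pos by simp
  also have "\<dots> = (\<Sum>y\<in>king_box n. \<Sum>x | x \<in> ?T \<and> x \<in> king_nbhd y. 1 / ?d y)"
    using king_nbhd_subset_king_box by (intro sum.cong) (auto intro!: arg_cong[where f = card])
  also have "\<dots> = (\<Sum>x\<in>?T. \<Sum>y | y \<in> king_box n \<and> x \<in> king_nbhd y. 1 / ?d y)"
    by (rule sum.swap_restrict) auto
  \<comment> \<open>Dropping the restriction to the box only adds nonnegative terms.\<close>
  also have "\<dots> \<le> (\<Sum>x\<in>?T. \<Sum>y\<in>king_nbhd x. 1 / ?d y)"
    by (intro sum_mono sum_mono2) (auto simp: king_nbhd_commute)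
  also have "\<dots> \<le> (\<Sum>x\<in>?T. 7 / 2)"
    using share_le[OF S] by (intro sum_mono) auto
  finally show ?thesis
    by simp
qed

lemma king_density_ge:
  assumes S: "king_redic S"
  shows "king_density S \<ge> ereal (2 / 7)"
proof -
  let ?r = "\<lambda>n. real (card (S \<inter> king_box n)) / real (card (king_box n))"
  \<comment> \<open>This is the bound from the box of radius \<open>n - 1\<close>, whose side is
    \<open>2 * n - 1\<close>; hence \<open>n > 0\<close> below.\<close>
  let ?q = "\<lambda>n. 2 / 7 * (2 * real n - 1)\<^sup>2 / (2 * real n + 1)\<^sup>2"
  have "?q n \<le> ?r n" if "n > 0" for n
  proof -
    obtain m where m: "n = Suc m"
      using gr0_implies_Suc[OF \<open>n > 0\<close>] by blast
    have "2 / 7 * (2 * real n - 1)\<^sup>2 \<le> real (card (S \<inter> king_box n))"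
      using card_king_box_le[OF S, of m] by (simp add: m card_king_box algebra_simps)
    moreover have "real (card (king_box n)) = (2 * real n + 1)\<^sup>2"
      by (simp add: card_king_box algebra_simps)
    ultimately show ?thesis
      by (simp only: divide_right_mono zero_le_power2)
  qed
  then have le: "eventually (\<lambda>n. ereal (?q n) \<le> ereal (?r n)) sequentially"
    by (auto intro: eventually_mono[OF eventually_gt_at_top[of 0]])
  have "?q \<longlonglongrightarrow> 2 / 7"
    by real_asymp
  then have "limsup (\<lambda>n. ereal (?q n)) = ereal (2 / 7)"
    by (intro lim_imp_Limsup) simp_all
  then show ?thesis
    using Limsup_mono[OF le] by (simp add: king_density_def)
qed

theorem corollary6p1:
  shows "king_REDIC_density \<ge> ereal (3 / 11)"
  unfolding king_REDIC_density_def
proof (rule INF_greatest)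
  fix S
  assume "S \<in> {S. king_redic S}"
  then have "ereal (2 / 7) \<le> king_density S"
    using king_density_ge by simp
  moreover have "ereal (3 / 11) \<le> ereal (2 / 7)"
    by simp
  ultimately show "ereal (3 / 11) \<le> king_density S"
    by (rule order_trans[rotated])
qed

end
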